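(* Let $\mathsf{JL}$ be any justification logic from the list in the context and $\mathsf{CS}$ a constant specification for $\mathsf{JL}$. If the sequent $\Gamma\Rightarrow\Delta$ is derivable in $\mathsf{G3JL}_{\mathsf{CS}}$, then it is valid in every $\mathsf{JL}_{\mathsf{CS}}$-model.
   Context: Justification logics. Terms are built from justification variables and constants by binary $\cdot,+$ and (depending on the logic) unary $!$, $?$, $\bar{?}$. Formulas are built from propositional variables and $\bot$ by $\neg,\wedge,\vee,\to$ and $t:A$. $Tm$, $Fm$ denote the sets of terms and formulas of $\mathsf{JL}$. $\mathsf J$ has axiom schemes: propositional tautologies; $s:A\to(s+t):A$, $s:A\to(t+s):A$; $s:(A\to B)\to(t:A\to(s\cdot t):B)$. A justification logic $\mathsf{JL}$ is $\mathsf J$ extended by at most one of (jT) $t:A\to A$, (jD) $t:\bot\to\bot$, and by any subset of (j4) $t:A\to\,!t:t:A$, (jB) $\neg A\to\bar{?}t:\neg t:A$, (j5) $\neg t:A\to\,?t:\neg t:A$; its language contains $!$ (resp. $\bar{?}$, $?$) exactly when (j4) (resp. (jB), (j5)) is an axiom. A constant specification $\mathsf{CS}$ for $\mathsf{JL}$: if (j4) is not an axiom, a set of formulas $c_n:\dots:c_1:A$ ($n\ge1$, $c_j$ constants, $A$ an axiom instance), closed under passing from $c_n:c_{n-1}:\dots:c_1:A$ to $c_{n-1}:\dots:c_1:A$; if (j4) is an axiom, a set of formulas $c:A$ ($c$ a constant, $A$ an axiom instance). Models. A $\mathsf{JL}_{\mathsf{CS}}$-model (Fitting model) is $\mathcal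 M=(\mathcal W,\mathcal R,\mathcal E,\mathcal V)$ with $\mathcal W\neq\emptyset$, $\mathcal R\subseteq\mathcal W\times\mathcal W$, $\mathcal V$ a map from propositional variables to subsets of $\mathcal W$, and $\mathcal E:Tm\times Fm\to 2^{\mathcal W}$ with $\mathcal E(c,F)=\mathcal W$ for each $c:F\in\mathsf{CS}$. Forcing: $(\mathcal M,w)\Vdash P$ iff $w\in\mathcal V(P)$; Boolean connectives are classical; $(\mathcal M,w)\Vdash t:F$ iff $w\in\mathcal E(t,F)$ and $(\mathcal M,v)\Vdash F$ for all $v$ with $w\mathcal Rv$. Conditions: $\mathcal E(s,A\to B)\cap\mathcal E(t,A)\subseteq\mathcal E(s\cdot t,B)$; $\mathcal E(s,A)\cup\mathcal E(t,A)\subseteq\mathcal E(s+t,A)$; if (jT) is an axiom, $\mathcal R$ is reflexive; if (jD), $\mathcal R$ is serial; if (j4), $\mathcal R$ is transitive, $w\in\mathcal E(t,A)$ and $w\mathcal Rv$ imply $v\in\mathcal E(t,A)$, and $\mathcal E(t,A)\subseteq\mathcal E(!t,t:A)$; if (jB), $\mathcal R$ is symmetric and $(\mathcal M,w)\Vdash\neg A$ implies $w\in\mathcal E(\bar{?}t,\neg t:A)$ for all $t$; if (j5), $\mathcal W\setminus\mathcal E(t,A)\subseteq\mathcal E(?t,\neg t:A)$, and $w\in\mathcal E(t,A)$ implies $(\mathcal M,w)\Vdash t:A$. Calculus $\mathsf{G3JL}_{\mathsf{CS}}$. Fix a countably infinite set $L$ of labels $w,v,u,\dots$. The labeled language has labeled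 formulas $w\Vvdash A$, relational atoms $wRv$ and evidence atoms $wE(t,A)$ ($A$ a formula, $t$ a term). Sequents $\Gamma\Rightarrow\Delta$ consist of finite multisets of these. Initial sequents: $w\Vvdash P,\Gamma\Rightarrow\Delta,w\Vvdash P$ ($P$ a propositional variable); $w\Vvdash\bot,\Gamma\Rightarrow\Delta$; $wRv,\Gamma\Rightarrow\Delta,wRv$; $wE(t,A),\Gamma\Rightarrow\Delta,wE(t,A)$. Rules (premises / conclusion): (L$\neg$) $\Gamma\Rightarrow\Delta,w\Vvdash A$ / $w\Vvdash\neg A,\Gamma\Rightarrow\Delta$; (R$\neg$) $w\Vvdash A,\Gamma\Rightarrow\Delta$ / $\Gamma\Rightarrow\Delta,w\Vvdash\neg A$; (L$\wedge$) $w\Vvdash A,w\Vvdash B,\Gamma\Rightarrow\Delta$ / $w\Vvdash A\wedge B,\Gamma\Rightarrow\Delta$; (R$\wedge$) $\Gamma\Rightarrow\Delta,w\Vvdash A$ and $\Gamma\Rightarrow\Delta,w\Vvdash B$ / $\Gamma\Rightarrow\Delta,w\Vvdash A\wedge B$; (L$\vee$) $w\Vvdash A,\Gamma\Rightarrow\Delta$ and $w\Vvdash B,\Gamma\Rightarrow\Delta$ / $w\Vvdash A\vee B,\Gamma\Rightarrow\Delta$; (R$\vee$) $\Gamma\Rightarrow\Delta,w\Vvdash A,w\Vvdash B$ / $\Gamma\Rightarrow\Delta,w\Vvdash A\vee B$; (L$\to$) $\Gamma\Rightarrow\Delta,w\Vvdash A$ and $w\Vvdash B,\Gamma\Rightarrow\Delta$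 / $w\Vvdash A\to B,\Gamma\Rightarrow\Delta$; (R$\to$) $w\Vvdash A,\Gamma\Rightarrow\Delta,w\Vvdash B$ / $\Gamma\Rightarrow\Delta,w\Vvdash A\to B$; (L:) $v\Vvdash A,w\Vvdash t:A,wRv,\Gamma\Rightarrow\Delta$ / $w\Vvdash t:A,wRv,\Gamma\Rightarrow\Delta$; (R:) $wRv,wE(t,A),\Gamma\Rightarrow\Delta,v\Vvdash A$ / $wE(t,A),\Gamma\Rightarrow\Delta,w\Vvdash t:A$, where the eigenlabel $v$ does not occur in the conclusion; (E) $wE(t,A),w\Vvdash t:A,\Gamma\Rightarrow\Delta$ / $w\Vvdash t:A,\Gamma\Rightarrow\Delta$; (El+) $wE(s+t,A),wE(t,A),\Gamma\Rightarrow\Delta$ / $wE(t,A),\Gamma\Rightarrow\Delta$; (Er+) $wE(t+s,A),wE(t,A),\Gamma\Rightarrow\Delta$ / $wE(t,A),\Gamma\Rightarrow\Delta$; (E$\cdot$) $wE(s\cdot t,B),wE(s,A\to B),wE(t,A),\Gamma\Rightarrow\Delta$ / $wE(s,A\to B),wE(t,A),\Gamma\Rightarrow\Delta$; (IAN)/(AN) $wE(c,F),\Gamma\Rightarrow\Delta$ / $\Gamma\Rightarrow\Delta$, for $c:F\in\mathsf{CS}$ ($c$ a constant). If (jT) is an axiom: (Ref) $wRw,\Gamma\Rightarrow\Delta$ / $\Gamma\Rightarrow\Delta$. If (jD) is an axiom: (Ser) $wRv,\Gamma\Rightarrow\Delta$ / $\Gamma\Rightarrow\Delta$, where the eigenlabel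 $v$ does not occur in the conclusion. If (j4) is an axiom: (E!) $wE(!t,t:A),wE(t,A),\Gamma\Rightarrow\Delta$ / $wE(t,A),\Gamma\Rightarrow\Delta$; (Mon) $vE(t,A),wE(t,A),wRv,\Gamma\Rightarrow\Delta$ / $wE(t,A),wRv,\Gamma\Rightarrow\Delta$; (Trans) $wRu,wRv,vRu,\Gamma\Rightarrow\Delta$ / $wRv,vRu,\Gamma\Rightarrow\Delta$. If (jB) is an axiom: (E$\bar{?}$) $w\Vvdash A,\Gamma\Rightarrow\Delta$ and $wE(\bar{?}t,\neg t:A),\Gamma\Rightarrow\Delta$ / $\Gamma\Rightarrow\Delta$; (Sym) $vRw,wRv,\Gamma\Rightarrow\Delta$ / $wRv,\Gamma\Rightarrow\Delta$. If (j5) is an axiom: (SE) $w\Vvdash t:A,wE(t,A),\Gamma\Rightarrow\Delta$ / $wE(t,A),\Gamma\Rightarrow\Delta$; (E?) $wE(t,A),\Gamma\Rightarrow\Delta$ and $wE(?t,\neg t:A),\Gamma\Rightarrow\Delta$ / $\Gamma\Rightarrow\Delta$. Validity. An $\mathcal M$-interpretation is a function $[\cdot]:L\to\mathcal W$. It validates $w\Vvdash A$ if $(\mathcal M,[w])\Vdash A$, validates $wRv$ if $[w]\mathcal R[v]$, and validates $wE(t,A)$ if $[w]\in\mathcal E(t,A)$. A sequent $\Gamma\Rightarrow\Delta$ is valid in $\mathcal M$ if every $\mathcal M$-interpretation that validates all formulas of $\Gamma$ validates at least one formula of $\Delta$. *)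

theory Defs
  imports Main "HOL-Library.Multiset"
begin

text \<open>A justification logic is given by the set \<open>X\<close> of axiom schemes it adds to J. All possible
  term operations are in the datatype; \<open>is_Tm X\<close> and \<open>is_Fm X\<close> single out the terms and formulas
  of the language of the logic \<open>X\<close>.\<close>

datatype ext_axiom = jT | jD | j4 | jB | j5

definition justification_logic :: "ext_axiom set \<Rightarrow> bool" where
  "justification_logic X \<longleftrightarrow> \<not> (jT \<in> X \<and> jD \<in> X)"

datatype ('x, 'c) trm =
    JVar 'x
  | JConst 'c
  | App "('x, 'c) trm" "('x, 'c) trm"
  | Plus "('x, 'c) trm" "('x, 'c) trm"
  | Bang "('x, 'c) trm"
  | Quest "('x, 'c) trm"
  | BarQuest "('x, 'c) trm"

datatype ('x, 'c, 'p) fm =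
    PVar 'p
  | Bot
  | Neg "('x, 'c, 'p) fm"
  | And "('x, 'c, 'p) fm" "('x, 'c, 'p) fm"
  | Or "('x, 'c, 'p) fm" "('x, 'c, 'p) fm"
  | Imp "('x, 'c, 'p) fm" "('x, 'c, 'p) fm"
  | Just "('x, 'c) trm" "('x, 'c, 'p) fm"

primrec is_Tm :: "ext_axiom set \<Rightarrow> ('x, 'c) trm \<Rightarrow> bool" where
  "is_Tm X (JVar x) \<longleftrightarrow> True"
| "is_Tm X (JConst c) \<longleftrightarrow> True"
| "is_Tm X (App s t) \<longleftrightarrow> is_Tm X s \<and> is_Tm X t"
| "is_Tm X (Plus s t) \<longleftrightarrow> is_Tm X s \<and> is_Tm X t"
| "is_Tm X (Bang t) \<longleftrightarrow> j4 \<in> X \<and> is_Tm X t"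
| "is_Tm X (Quest t) \<longleftrightarrow> j5 \<in> X \<and> is_Tm X t"
| "is_Tm X (BarQuest t) \<longleftrightarrow> jB \<in> X \<and> is_Tm X t"

primrec is_Fm :: "ext_axiom set \<Rightarrow> ('x, 'c, 'p) fm \<Rightarrow> bool" where
  "is_Fm X (PVar p) \<longleftrightarrow> True"
| "is_Fm X Bot \<longleftrightarrow> True"
| "is_Fm X (Neg A) \<longleftrightarrow> is_Fm X A"
| "is_Fm X (And A B) \<longleftrightarrow> is_Fm X A \<and> is_Fm X B"
| "is_Fm X (Or A B) \<longleftrightarrow> is_Fm X A \<and> is_Fm X B"
| "is_Fm X (Imp A B) \<longleftrightarrow> is_Fm X A \<and> is_Fm X B"
| "is_Fm X (Just t A) \<longleftrightarrow> is_Tm X t \<and> is_Fm X A"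

text \<open>Propositional tautologies: formulas \<open>t:A\<close> count as propositional atoms.\<close>

primrec prop_eval :: "(('x, 'c, 'p) fm \<Rightarrow> bool) \<Rightarrow> ('x, 'c, 'p) fm \<Rightarrow> bool" where
  "prop_eval e (PVar p) \<longleftrightarrow> e (PVar p)"
| "prop_eval e Bot \<longleftrightarrow> False"
| "prop_eval e (Neg A) \<longleftrightarrow> \<not> prop_eval e A"
| "prop_eval e (And A B) \<longleftrightarrow> prop_eval e A \<and> prop_eval e B"
| "prop_eval e (Or A B) \<longleftrightarrow> prop_eval e A \<or> prop_eval e B"
| "prop_eval e (Imp A B) \<longleftrightarrow> (prop_eval e A \<longrightarrow> prop_eval e B)"
| "prop_eval e (Just t A) \<longleftrightarrow> e (Just t A)"

definition tautology :: "('x, 'c, 'p) fm \<Rightarrow> bool" where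
  "tautology A \<longleftrightarrow> (\<forall>e. prop_eval e A)"

inductive axiom_scheme :: "ext_axiom set \<Rightarrow> ('x, 'c, 'p) fm \<Rightarrow> bool" for X where
  "tautology A \<Longrightarrow> axiom_scheme X A"
| "axiom_scheme X (Imp (Just s A) (Just (Plus s t) A))"
| "axiom_scheme X (Imp (Just s A) (Just (Plus t s) A))"
| "axiom_scheme X (Imp (Just s (Imp A B)) (Imp (Just t A) (Just (App s t) B)))"
| "jT \<in> X \<Longrightarrow> axiom_scheme X (Imp (Just t A) A)"
| "jD \<in> X \<Longrightarrow> axiom_scheme X (Imp (Just t Bot) Bot)"
| "j4 \<in> X \<Longrightarrow> axiom_scheme X (Imp (Just t A) (Just (Bang t) (Just t A)))"
| "jB \<in> X \<Longrightarrow> axiom_scheme X (Imp (Neg A) (Just (BarQuest t) (Neg (Just t A))))"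
| "j5 \<in> X \<Longrightarrow> axiom_scheme X (Imp (Neg (Just t A)) (Just (Quest t) (Neg (Just t A))))"

definition axiom_instance :: "ext_axiom set \<Rightarrow> ('x, 'c, 'p) fm \<Rightarrow> bool" where
  "axiom_instance X A \<longleftrightarrow> axiom_scheme X A \<and> is_Fm X A"

text \<open>\<open>const_chain [c\<^sub>n, \<dots>, c\<^sub>1] A\<close> is \<open>c\<^sub>n:\<dots>:c\<^sub>1:A\<close>.\<close>

definition const_chain :: "'c list \<Rightarrow> ('x, 'c, 'p) fm \<Rightarrow> ('x, 'c, 'p) fm" where
  "const_chain cs A = foldr (\<lambda>c. Just (JConst c)) cs A"

definition constant_specification :: "ext_axiom set \<Rightarrow> ('x, 'c, 'p) fm set \<Rightarrow> bool" where
  "constant_specification X CS \<longleftrightarrow>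
    (if j4 \<in> X
     then CS \<subseteq> {Just (JConst c) A | c A. axiom_instance X A}
     else CS \<subseteq> {const_chain cs A | cs A. cs \<noteq> [] \<and> axiom_instance X A} \<and>
       (\<forall>c cs A. cs \<noteq> [] \<and> axiom_instance X A \<and> const_chain (c # cs) A \<in> CS
          \<longrightarrow> const_chain cs A \<in> CS))"

record ('w, 'x, 'c, 'p) fitting_model =
  worlds :: "'w set"
  acc :: "('w \<times> 'w) set"
  evid :: "('x, 'c) trm \<Rightarrow> ('x, 'c, 'p) fm \<Rightarrow> 'w set"
  val :: "'p \<Rightarrow> 'w set"

primrec forces :: "('w, 'x, 'c, 'p) fitting_model \<Rightarrow> 'w \<Rightarrow> ('x, 'c, 'p) fm \<Rightarrow> bool" where
  "forces M w (PVar p) \<longleftrightarrow> w \<in> val M p"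
| "forces M w Bot \<longleftrightarrow> False"
| "forces M w (Neg A) \<longleftrightarrow> \<not> forces M w A"
| "forces M w (And A B) \<longleftrightarrow> forces M w A \<and> forces M w B"
| "forces M w (Or A B) \<longleftrightarrow> forces M w A \<or> forces M w B"
| "forces M w (Imp A B) \<longleftrightarrow> (forces M w A \<longrightarrow> forces M w B)"
| "forces M w (Just t A) \<longleftrightarrow> w \<in> evid M t A \<and> (\<forall>v. (w, v) \<in> acc M \<longrightarrow> forces M v A)"

text \<open>The evidence function is only constrained on the language of \<open>X\<close>; its values on other
  arguments are junk.\<close>

definition JL_model ::
  "ext_axiom set \<Rightarrow> ('x, 'c, 'p) fm set \<Rightarrow> ('w, 'x, 'c, 'p) fitting_model \<Rightarrow> bool" where
  "JL_model X CS M \<longleftrightarrow>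
    worlds M \<noteq> {} \<and>
    acc M \<subseteq> worlds M \<times> worlds M \<and>
    (\<forall>p. val M p \<subseteq> worlds M) \<and>
    (\<forall>t A. is_Tm X t \<and> is_Fm X A \<longrightarrow> evid M t A \<subseteq> worlds M) \<and>
    (\<forall>c F. Just (JConst c) F \<in> CS \<longrightarrow> evid M (JConst c) F = worlds M) \<and>
    (\<forall>s t A B. is_Tm X s \<and> is_Tm X t \<and> is_Fm X A \<and> is_Fm X B \<longrightarrow>
       evid M s (Imp A B) \<inter> evid M t A \<subseteq> evid M (App s t) B) \<and>
    (\<forall>s t A. is_Tm X s \<and> is_Tm X t \<and> is_Fm X A \<longrightarrow>
       evid M s A \<union> evid M t A \<subseteq> evid M (Plus s t) A) \<and>
    (jT \<in> X \<longrightarrow> refl_on (worlds M) (acc M)) \<and>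
    (jD \<in> X \<longrightarrow> (\<forall>w \<in> worlds M. \<exists>v. (w, v) \<in> acc M)) \<and>
    (j4 \<in> X \<longrightarrow> trans (acc M) \<and>
       (\<forall>t A. is_Tm X t \<and> is_Fm X A \<longrightarrow>
          (\<forall>w v. w \<in> evid M t A \<and> (w, v) \<in> acc M \<longrightarrow> v \<in> evid M t A) \<and>
          evid M t A \<subseteq> evid M (Bang t) (Just t A))) \<and>
    (jB \<in> X \<longrightarrow> sym (acc M) \<and>
       (\<forall>t A. is_Tm X t \<and> is_Fm X A \<longrightarrow>
          (\<forall>w \<in> worlds M. forces M w (Neg A) \<longrightarrow>
             w \<in> evid M (BarQuest t) (Neg (Just t A))))) \<and>
    (j5 \<in> X \<longrightarrow>
       (\<forall>t A. is_Tm X t \<and> is_Fm X A \<longrightarrow>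
          worlds M - evid M t A \<subseteq> evid M (Quest t) (Neg (Just t A)) \<and>
          (\<forall>w \<in> evid M t A. forces M w (Just t A))))"

type_synonym label = nat

datatype ('x, 'c, 'p) lfm =
    Lab label "('x, 'c, 'p) fm"
  | Rel label label
  | Ev label "('x, 'c) trm" "('x, 'c, 'p) fm"

type_synonym ('x, 'c, 'p) cedent = "('x, 'c, 'p) lfm multiset"

primrec labels :: "('x, 'c, 'p) lfm \<Rightarrow> label set" where
  "labels (Lab w A) = {w}"
| "labels (Rel w v) = {w, v}"
| "labels (Ev w t A) = {w}"

definition occurs :: "label \<Rightarrow> ('x, 'c, 'p) cedent \<Rightarrow> ('x, 'c, 'p) cedent \<Rightarrow> bool" where
  "occurs v \<Gamma> \<Delta> \<longleftrightarrow> (\<exists>\<phi> \<in># \<Gamma> + \<Delta>. v \<in> labels \<phi>)"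

primrec in_lang :: "ext_axiom set \<Rightarrow> ('x, 'c, 'p) lfm \<Rightarrow> bool" where
  "in_lang X (Lab w A) \<longleftrightarrow> is_Fm X A"
| "in_lang X (Rel w v) \<longleftrightarrow> True"
| "in_lang X (Ev w t A) \<longleftrightarrow> is_Tm X t \<and> is_Fm X A"

definition lang_sequent ::
  "ext_axiom set \<Rightarrow> ('x, 'c, 'p) cedent \<Rightarrow> ('x, 'c, 'p) cedent \<Rightarrow> bool" where
  "lang_sequent X \<Gamma> \<Delta> \<longleftrightarrow> (\<forall>\<phi> \<in># \<Gamma> + \<Delta>. in_lang X \<phi>)"

text \<open>Membership in the language is imposed on initial sequents only: every rule passes it from the
  premises to the conclusion, so it holds throughout each derivation (\<open>G3_lang_sequent\<close> below).
  In \<open>Ser\<close>, as in every rule, different label variables may stand for the same label: the side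
  condition demands only that \<open>v\<close> does not occur in the conclusion, so \<open>w = v\<close> is
  permitted.\<close>

inductive G3 ::
  "ext_axiom set \<Rightarrow> ('x, 'c, 'p) fm set \<Rightarrow> ('x, 'c, 'p) cedent \<Rightarrow> ('x, 'c, 'p) cedent \<Rightarrow> bool"
  for X CS where
  AxP: "lang_sequent X ({#Lab w (PVar p)#} + \<Gamma>) (\<Delta> + {#Lab w (PVar p)#}) \<Longrightarrow>
    G3 X CS ({#Lab w (PVar p)#} + \<Gamma>) (\<Delta> + {#Lab w (PVar p)#})"
| AxBot: "lang_sequent X ({#Lab w Bot#} + \<Gamma>) \<Delta> \<Longrightarrow>
    G3 X CS ({#Lab w Bot#} + \<Gamma>) \<Delta>"
| AxR: "lang_sequent X ({#Rel w v#} + \<Gamma>) (\<Delta> + {#Rel w v#}) \<Longrightarrow>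
    G3 X CS ({#Rel w v#} + \<Gamma>) (\<Delta> + {#Rel w v#})"
| AxE: "lang_sequent X ({#Ev w t A#} + \<Gamma>) (\<Delta> + {#Ev w t A#}) \<Longrightarrow>
    G3 X CS ({#Ev w t A#} + \<Gamma>) (\<Delta> + {#Ev w t A#})"
| LNeg: "G3 X CS \<Gamma> (\<Delta> + {#Lab w A#}) \<Longrightarrow>
    G3 X CS ({#Lab w (Neg A)#} + \<Gamma>) \<Delta>"
| RNeg: "G3 X CS ({#Lab w A#} + \<Gamma>) \<Delta> \<Longrightarrow>
    G3 X CS \<Gamma> (\<Delta> + {#Lab w (Neg A)#})"
| LAnd: "G3 X CS ({#Lab w A, Lab w B#} + \<Gamma>) \<Delta> \<Longrightarrow>
    G3 X CS ({#Lab w (And A B)#} + \<Gamma>) \<Delta>"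
| RAnd: "G3 X CS \<Gamma> (\<Delta> + {#Lab w A#}) \<Longrightarrow> G3 X CS \<Gamma> (\<Delta> + {#Lab w B#}) \<Longrightarrow>
    G3 X CS \<Gamma> (\<Delta> + {#Lab w (And A B)#})"
| LOr: "G3 X CS ({#Lab w A#} + \<Gamma>) \<Delta> \<Longrightarrow> G3 X CS ({#Lab w B#} + \<Gamma>) \<Delta> \<Longrightarrow>
    G3 X CS ({#Lab w (Or A B)#} + \<Gamma>) \<Delta>"
| ROr: "G3 X CS \<Gamma> (\<Delta> + {#Lab w A, Lab w B#}) \<Longrightarrow>
    G3 X CS \<Gamma> (\<Delta> + {#Lab w (Or A B)#})"
| LImp: "G3 X CS \<Gamma> (\<Delta> + {#Lab w A#}) \<Longrightarrow> G3 X CS ({#Lab w B#} + \<Gamma>) \<Delta> \<Longrightarrow>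
    G3 X CS ({#Lab w (Imp A B)#} + \<Gamma>) \<Delta>"
| RImp: "G3 X CS ({#Lab w A#} + \<Gamma>) (\<Delta> + {#Lab w B#}) \<Longrightarrow>
    G3 X CS \<Gamma> (\<Delta> + {#Lab w (Imp A B)#})"
| LJust: "G3 X CS ({#Lab v A, Lab w (Just t A), Rel w v#} + \<Gamma>) \<Delta> \<Longrightarrow>
    G3 X CS ({#Lab w (Just t A), Rel w v#} + \<Gamma>) \<Delta>"
| RJust: "G3 X CS ({#Rel w v, Ev w t A#} + \<Gamma>) (\<Delta> + {#Lab v A#}) \<Longrightarrow>
    \<not> occurs v ({#Ev w t A#} + \<Gamma>) (\<Delta> + {#Lab w (Just t A)#}) \<Longrightarrow>
    G3 X CS ({#Ev w t A#} + \<Gamma>) (\<Delta> + {#Lab w (Just t A)#})"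
| E: "G3 X CS ({#Ev w t A, Lab w (Just t A)#} + \<Gamma>) \<Delta> \<Longrightarrow>
    G3 X CS ({#Lab w (Just t A)#} + \<Gamma>) \<Delta>"
| ElPlus: "G3 X CS ({#Ev w (Plus s t) A, Ev w t A#} + \<Gamma>) \<Delta> \<Longrightarrow>
    G3 X CS ({#Ev w t A#} + \<Gamma>) \<Delta>"
| ErPlus: "G3 X CS ({#Ev w (Plus t s) A, Ev w t A#} + \<Gamma>) \<Delta> \<Longrightarrow>
    G3 X CS ({#Ev w t A#} + \<Gamma>) \<Delta>"
| EApp: "G3 X CS ({#Ev w (App s t) B, Ev w s (Imp A B), Ev w t A#} + \<Gamma>) \<Delta> \<Longrightarrow>
    G3 X CS ({#Ev w s (Imp A B), Ev w t A#} + \<Gamma>) \<Delta>"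
| AN: "Just (JConst c) F \<in> CS \<Longrightarrow> G3 X CS ({#Ev w (JConst c) F#} + \<Gamma>) \<Delta> \<Longrightarrow>
    G3 X CS \<Gamma> \<Delta>"
| Ref: "jT \<in> X \<Longrightarrow> G3 X CS ({#Rel w w#} + \<Gamma>) \<Delta> \<Longrightarrow>
    G3 X CS \<Gamma> \<Delta>"
| Ser: "jD \<in> X \<Longrightarrow> G3 X CS ({#Rel w v#} + \<Gamma>) \<Delta> \<Longrightarrow> \<not> occurs v \<Gamma> \<Delta> \<Longrightarrow>
    G3 X CS \<Gamma> \<Delta>"
| EBang: "j4 \<in> X \<Longrightarrow> G3 X CS ({#Ev w (Bang t) (Just t A), Ev w t A#} + \<Gamma>) \<Delta> \<Longrightarrow>
    G3 X CS ({#Ev w t A#} + \<Gamma>) \<Delta>"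
| Mon: "j4 \<in> X \<Longrightarrow> G3 X CS ({#Ev v t A, Ev w t A, Rel w v#} + \<Gamma>) \<Delta> \<Longrightarrow>
    G3 X CS ({#Ev w t A, Rel w v#} + \<Gamma>) \<Delta>"
| Trans: "j4 \<in> X \<Longrightarrow> G3 X CS ({#Rel w u, Rel w v, Rel v u#} + \<Gamma>) \<Delta> \<Longrightarrow>
    G3 X CS ({#Rel w v, Rel v u#} + \<Gamma>) \<Delta>"
| EBarQuest: "jB \<in> X \<Longrightarrow> G3 X CS ({#Lab w A#} + \<Gamma>) \<Delta> \<Longrightarrow>
    G3 X CS ({#Ev w (BarQuest t) (Neg (Just t A))#} + \<Gamma>) \<Delta> \<Longrightarrow>
    G3 X CS \<Gamma> \<Delta>"
| Sym: "jB \<in> X \<Longrightarrow> G3 X CS ({#Rel v w, Rel w v#} + \<Gamma>) \<Delta> \<Longrightarrow>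
    G3 X CS ({#Rel w v#} + \<Gamma>) \<Delta>"
| SE: "j5 \<in> X \<Longrightarrow> G3 X CS ({#Lab w (Just t A), Ev w t A#} + \<Gamma>) \<Delta> \<Longrightarrow>
    G3 X CS ({#Ev w t A#} + \<Gamma>) \<Delta>"
| EQuest: "j5 \<in> X \<Longrightarrow> G3 X CS ({#Ev w t A#} + \<Gamma>) \<Delta> \<Longrightarrow>
    G3 X CS ({#Ev w (Quest t) (Neg (Just t A))#} + \<Gamma>) \<Delta> \<Longrightarrow>
    G3 X CS \<Gamma> \<Delta>"

lemma G3_lang_sequent: "G3 X CS \<Gamma> \<Delta> \<Longrightarrow> lang_sequent X \<Gamma> \<Delta>"
  by (induction rule: G3.induct) (auto simp: lang_sequent_def)

primrec holds ::
  "('w, 'x, 'c, 'p) fitting_model \<Rightarrow> (label \<Rightarrow> 'w) \<Rightarrow> ('x, 'c, 'p) lfm \<Rightarrow> bool" where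
  "holds M I (Lab w A) \<longleftrightarrow> forces M (I w) A"
| "holds M I (Rel w v) \<longleftrightarrow> (I w, I v) \<in> acc M"
| "holds M I (Ev w t A) \<longleftrightarrow> I w \<in> evid M t A"

definition valid_sequent ::
  "('w, 'x, 'c, 'p) fitting_model \<Rightarrow> ('x, 'c, 'p) cedent \<Rightarrow> ('x, 'c, 'p) cedent \<Rightarrow> bool" where
  "valid_sequent M \<Gamma> \<Delta> \<longleftrightarrow>
    (\<forall>I. range I \<subseteq> worlds M \<longrightarrow> (\<forall>\<phi> \<in># \<Gamma>. holds M I \<phi>) \<longrightarrow> (\<exists>\<phi> \<in># \<Delta>. holds M I \<phi>))"

end

theory Submission
  imports Defs
begin

text \<open>The proof is by induction on derivations, each rule preserving validity in a fixed model.
  All but one of the rules are sound because they mirror a clause of the forcing relation or a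
  closure condition of Fitting models. The exception is the rule \<open>Ser\<close>: its side condition asks
  only that \<open>v\<close> be absent from the conclusion, so the active atom may be \<open>v R v\<close> with \<open>v\<close> fresh.
  To discharge such an atom the model needs a reflexive world, which seriality does not provide;
  \<open>G3_sound_reflexive_world\<close> therefore assumes one.

  An arbitrary model \<open>M\<close> is reduced to this case by adding to it one isolated reflexive world.
  There a formula is evaluated by its forgetful projection, which erases all terms, and every term
  is evidence for exactly the true formulas. Erasing terms turns each axiom of each of the logics
  into a propositional tautology, so the new world respects every constant specification. The
  closure conditions on evidence hold there because each of them, read with "\<open>t\<close> is evidence for
  \<open>A\<close>" as "\<open>A\<close> is true", is propositionally valid, and the conditions on accessibility hold because
  the new world sees exactly itself (\<open>JL_model_add_point\<close>). Since it is not accessible from the old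
  worlds, forcing at these is unchanged, and a sequent valid in the enlarged model is valid in \<open>M\<close>
  (\<open>valid_sequent_add_pointD\<close>).\<close>

section \<open>Forgetful truth\<close>

text \<open>Making every propositional variable false is an arbitrary choice: axioms become tautologies,
  so they are true under each valuation.\<close>

primrec forgetful_true :: "('x, 'c, 'p) fm \<Rightarrow> bool" where
  "forgetful_true (PVar p) \<longleftrightarrow> False"
| "forgetful_true Bot \<longleftrightarrow> False"
| "forgetful_true (Neg A) \<longleftrightarrow> \<not> forgetful_true A"
| "forgetful_true (And A B) \<longleftrightarrow> forgetful_true A \<and> forgetful_true B"
| "forgetful_true (Or A B) \<longleftrightarrow> forgetful_true A \<or> forgetful_true B"
| "forgetful_true (Imp A B) \<longleftrightarrow> (forgetful_true A \<longrightarrow> forgetful_true B)"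
| "forgetful_true (Just t A) \<longleftrightarrow> forgetful_true A"

text \<open>Forgetful truth is a propositional valuation on all formulas, those of the form \<open>t:A\<close>
  included, so tautologies are true.\<close>

lemma prop_eval_forgetful_true: "prop_eval forgetful_true A \<longleftrightarrow> forgetful_true A"
  by (induction A) auto

lemma tautology_forgetful_true: "tautology A \<Longrightarrow> forgetful_true A"
  unfolding tautology_def using prop_eval_forgetful_true by blast

lemma axiom_scheme_forgetful_true: "axiom_scheme X A \<Longrightarrow> forgetful_true A"
  by (induction rule: axiom_scheme.induct) (auto simp: tautology_forgetful_true)

lemma forgetful_true_const_chain: "forgetful_true (const_chain cs A) \<longleftrightarrow> forgetful_true A"
  by (induction cs) (auto simp: const_chain_def)

lemma constant_specification_forgetful_true:
  assumes "constant_specification X CS" and "F \<in> CS"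
  shows "forgetful_true F"
proof (cases "j4 \<in> X")
  case True
  then show ?thesis
    using assms
    by (auto simp: constant_specification_def axiom_instance_def axiom_scheme_forgetful_true)
next
  case False
  then have "CS \<subseteq> {const_chain cs A | cs A. cs \<noteq> [] \<and> axiom_instance X A}"
    using assms(1) by (simp add: constant_specification_def)
  then show ?thesis
    using assms(2)
    by (auto simp: axiom_instance_def axiom_scheme_forgetful_true forgetful_true_const_chain)
qed

section \<open>The conditions on models\<close>

context
  fixes X CS and M :: "('w, 'x, 'c, 'p) fitting_model"
  assumes M: "JL_model X CS M"
begin

lemma JL_model_acc:
  "acc M \<subseteq> worlds M \<times> worlds M"
  using M by (simp add: JL_model_def)

lemma JL_model_val:
  "val M p \<subseteq> worlds M"
  using M by (simp add: JL_model_def)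

lemma JL_model_evid:
  "is_Tm X t \<Longrightarrow> is_Fm X A \<Longrightarrow> evid M t A \<subseteq> worlds M"
  using M by (simp add: JL_model_def)

lemma JL_model_const:
  "Just (JConst c) F \<in> CS \<Longrightarrow> evid M (JConst c) F = worlds M"
  using M by (simp add: JL_model_def)

lemma JL_model_App:
  "is_Tm X s \<Longrightarrow> is_Tm X t \<Longrightarrow> is_Fm X A \<Longrightarrow> is_Fm X B \<Longrightarrow>
    evid M s (Imp A B) \<inter> evid M t A \<subseteq> evid M (App s t) B"
  using M by (simp add: JL_model_def)

lemma JL_model_Plus:
  "is_Tm X s \<Longrightarrow> is_Tm X t \<Longrightarrow> is_Fm X A \<Longrightarrow>
    evid M s A \<union> evid M t A \<subseteq> evid M (Plus s t) A"
  using M by (simp add: JL_model_def)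

lemma JL_model_refl:
  "jT \<in> X \<Longrightarrow> refl_on (worlds M) (acc M)"
  using M by (simp add: JL_model_def)

lemma JL_model_serial:
  "jD \<in> X \<Longrightarrow> w \<in> worlds M \<Longrightarrow> \<exists>v. (w, v) \<in> acc M"
  using M by (simp add: JL_model_def)

lemma JL_model_trans:
  "j4 \<in> X \<Longrightarrow> trans (acc M)"
  using M by (simp add: JL_model_def)

lemma JL_model_mono:
  "j4 \<in> X \<Longrightarrow> is_Tm X t \<Longrightarrow> is_Fm X A \<Longrightarrow>
    w \<in> evid M t A \<Longrightarrow> (w, v) \<in> acc M \<Longrightarrow> v \<in> evid M t A"
  using M by (auto simp: JL_model_def)

lemma JL_model_Bang:
  "j4 \<in> X \<Longrightarrow> is_Tm X t \<Longrightarrow> is_Fm X A \<Longrightarrow>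
    evid M t A \<subseteq> evid M (Bang t) (Just t A)"
  using M by (simp add: JL_model_def)

lemma JL_model_sym:
  "jB \<in> X \<Longrightarrow> sym (acc M)"
  using M by (simp add: JL_model_def)

lemma JL_model_BarQuest:
  "jB \<in> X \<Longrightarrow> is_Tm X t \<Longrightarrow> is_Fm X A \<Longrightarrow>
    w \<in> worlds M \<Longrightarrow> \<not> forces M w A \<Longrightarrow> w \<in> evid M (BarQuest t) (Neg (Just t A))"
  using M by (simp add: JL_model_def)

lemma JL_model_Quest:
  "j5 \<in> X \<Longrightarrow> is_Tm X t \<Longrightarrow> is_Fm X A \<Longrightarrow>
    worlds M - evid M t A \<subseteq> evid M (Quest t) (Neg (Just t A))"
  using M by (simp add: JL_model_def)

lemma JL_model_strong_evid:
  "j5 \<in> X \<Longrightarrow> is_Tm X t \<Longrightarrow> is_Fm X A \<Longrightarrow>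
    w \<in> evid M t A \<Longrightarrow> forces M w (Just t A)"
  using M by (simp add: JL_model_def)

end

section \<open>Adding an isolated reflexive world\<close>

definition add_point ::
  "('w, 'x, 'c, 'p) fitting_model \<Rightarrow> ('w option, 'x, 'c, 'p) fitting_model" where
  "add_point M =
    \<lparr>worlds = insert None (Some ` worlds M),
     acc = insert (None, None) (map_prod Some Some ` acc M),
     evid = (\<lambda>t A. Some ` evid M t A \<union> (if forgetful_true A then {None} else {})),
     val = (\<lambda>p. Some ` val M p)\<rparr>"

lemma add_point_simps:
  "worlds (add_point M) = insert None (Some ` worlds M)"
  "None \<in> evid (add_point M) t A \<longleftrightarrow> forgetful_true A"
  "Some w \<in> evid (add_point M) t A \<longleftrightarrow> w \<in> evid M t A"
  "(None, y) \<in> acc (add_point M) \<longleftrightarrow> y = None"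
  "(x, None) \<in> acc (add_point M) \<longleftrightarrow> x = None"
  "(Some w, Some v) \<in> acc (add_point M) \<longleftrightarrow> (w, v) \<in> acc M"
  "x \<in> val (add_point M) p \<longleftrightarrow> (\<exists>w \<in> val M p. x = Some w)"
  by (auto simp: add_point_def)

lemma forces_add_point_old: "forces (add_point M) (Some w) A \<longleftrightarrow> forces M w A"
proof (induction A arbitrary: w)
  case (Just t A)
  then show ?case
    by (simp add: add_point_simps split_option_all)
qed (auto simp: add_point_simps)

lemma forces_add_point_new: "forces (add_point M) None A \<longleftrightarrow> forgetful_true A"
  by (induction A) (auto simp: add_point_simps)

lemma JL_model_add_point:
  assumes M: "JL_model X CS M" and CS: "constant_specification X CS"
  shows "JL_model X CS (add_point M)"
proof -
  let ?M = "add_point M"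
  have CS_true: "forgetful_true F" if "Just t F \<in> CS" for t F
    using constant_specification_forgetful_true[OF CS that] by simp
  have nonempty: "worlds ?M \<noteq> {}"
    by (simp add: add_point_simps)
  have acc: "acc ?M \<subseteq> worlds ?M \<times> worlds ?M"
    using JL_model_acc[OF M] by (auto simp: add_point_def)
  have val: "val ?M p \<subseteq> worlds ?M" for p
    using JL_model_val[OF M] by (auto simp: add_point_def)
  have evid: "evid ?M t A \<subseteq> worlds ?M" if "is_Tm X t" "is_Fm X A" for t A
    using JL_model_evid[OF M that] by (auto simp: add_point_def)
  have const: "evid ?M (JConst c) F = worlds ?M" if "Just (JConst c) F \<in> CS" for c F
    using JL_model_const[OF M that] CS_true[OF that] by (simp add: add_point_def)
  have app: "evid ?M s (Imp A B) \<inter> evid ?M t A \<subseteq> evid ?M (App s t) B"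
    if "is_Tm X s" "is_Tm X t" "is_Fm X A" "is_Fm X B" for s t A B
    using JL_model_App[OF M that] by (auto simp: add_point_def)
  have plus: "evid ?M s A \<union> evid ?M t A \<subseteq> evid ?M (Plus s t) A"
    if "is_Tm X s" "is_Tm X t" "is_Fm X A" for s t A
    using JL_model_Plus[OF M that] by (auto simp: add_point_def)
  have refl: "refl_on (worlds ?M) (acc ?M)" if "jT \<in> X"
    using JL_model_refl[OF M that] by (auto simp: refl_on_def add_point_simps)
  have serial: "\<exists>v. (w, v) \<in> acc ?M" if "jD \<in> X" "w \<in> worlds ?M" for w
    using JL_model_serial[OF M that(1)] that(2)
    by (cases w) (auto simp: split_option_ex add_point_simps)
  have trans: "trans (acc ?M)" if "j4 \<in> X"
  proof (rule transI)
    fix x y z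
    assume "(x, y) \<in> acc ?M" "(y, z) \<in> acc ?M"
    then show "(x, z) \<in> acc ?M"
      by (cases x; cases y; cases z)
        (auto simp: add_point_simps intro: transD[OF JL_model_trans[OF M that]])
  qed
  have mono: "v \<in> evid ?M t A"
    if "j4 \<in> X" "is_Tm X t" "is_Fm X A" "w \<in> evid ?M t A" "(w, v) \<in> acc ?M" for t A w v
    using that(4,5) JL_model_mono[OF M that(1-3)] by (cases w; cases v) (auto simp: add_point_simps)
  have bang: "evid ?M t A \<subseteq> evid ?M (Bang t) (Just t A)"
    if "j4 \<in> X" "is_Tm X t" "is_Fm X A" for t A
    using JL_model_Bang[OF M that] by (auto simp: add_point_def)
  have sym: "sym (acc ?M)" if "jB \<in> X"
    using JL_model_sym[OF M that] by (auto simp: sym_def add_point_def)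
  have barquest: "w \<in> evid ?M (BarQuest t) (Neg (Just t A))"
    if "jB \<in> X" "is_Tm X t" "is_Fm X A" "w \<in> worlds ?M" "forces ?M w (Neg A)" for t A w
    using that(4,5) JL_model_BarQuest[OF M that(1-3)]
    by (cases w) (auto simp: add_point_simps forces_add_point_old forces_add_point_new)
  have quest: "worlds ?M - evid ?M t A \<subseteq> evid ?M (Quest t) (Neg (Just t A))"
    if "j5 \<in> X" "is_Tm X t" "is_Fm X A" for t A
    using JL_model_Quest[OF M that] by (auto simp: add_point_def)
  have strong: "forces ?M w (Just t A)"
    if "j5 \<in> X" "is_Tm X t" "is_Fm X A" "w \<in> evid ?M t A" for t A w
    using that(4) JL_model_strong_evid[OF M that(1-3)]
    by (cases w)
      (simp_all add: add_point_simps forces_add_point_old forces_add_point_new del: forces.simps)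
  show ?thesis
    unfolding JL_model_def
    by (intro conjI allI impI ballI; (elim conjE)?)
      (fact nonempty acc val | rule evid const app plus refl serial trans mono bang sym
        barquest quest strong; assumption)+
qed

lemma valid_sequent_add_pointD:
  assumes "valid_sequent (add_point M) \<Gamma> \<Delta>"
  shows "valid_sequent M \<Gamma> \<Delta>"
proof -
  have holds: "holds (add_point M) (Some \<circ> I) \<phi> \<longleftrightarrow> holds M I \<phi>" for I \<phi>
    by (cases \<phi>) (simp_all add: forces_add_point_old add_point_simps)
  have "\<exists>\<phi> \<in># \<Delta>. holds M I \<phi>"
    if "range I \<subseteq> worlds M" and "\<forall>\<phi> \<in># \<Gamma>. holds M I \<phi>" for I
  proof -
    have "range (Some \<circ> I) \<subseteq> worlds (add_point M)"
      using that(1) by (auto simp: add_point_simps)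
    then show ?thesis
      using assms that(2) unfolding valid_sequent_def by (metis holds)
  qed
  then show ?thesis unfolding valid_sequent_def by blast
qed

section \<open>Soundness in models with a reflexive world\<close>

lemma holds_fun_upd: "v \<notin> labels \<phi> \<Longrightarrow> holds M (I(v := x)) \<phi> \<longleftrightarrow> holds M I \<phi>"
  by (cases \<phi>) auto

text \<open>Most rules only remove from the antecedent an atom that the remaining ones force anyway.\<close>

lemma valid_sequent_entailed_left:
  assumes "valid_sequent M \<Gamma>' \<Delta>"
    and "\<And>I \<phi>. \<lbrakk>\<forall>w. I w \<in> worlds M; \<forall>\<psi> \<in># \<Gamma>. holds M I \<psi>; \<phi> \<in># \<Gamma>'\<rbrakk> \<Longrightarrow> holds M I \<phi>"
  shows "valid_sequent M \<Gamma> \<Delta>"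
  using assms unfolding valid_sequent_def by (meson range_subsetD)

text \<open>The rules \<open>EBarQuest\<close> and \<open>EQuest\<close> are case distinctions: by negative introspection, at every
  world one of the two atoms that their premises add to the antecedent holds.\<close>

lemma valid_sequent_cases_left:
  assumes "valid_sequent M ({#\<phi>#} + \<Gamma>) \<Delta>" and "valid_sequent M ({#\<psi>#} + \<Gamma>) \<Delta>"
    and "\<And>I. \<forall>w. I w \<in> worlds M \<Longrightarrow> holds M I \<phi> \<or> holds M I \<psi>"
  shows "valid_sequent M \<Gamma> \<Delta>"
  unfolding valid_sequent_def
proof (intro allI impI)
  fix I
  assume I: "range I \<subseteq> worlds M" and "\<forall>\<phi> \<in># \<Gamma>. holds M I \<phi>"
  moreover from I have "holds M I \<phi> \<or> holds M I \<psi>"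
    using assms(3) by (meson range_subsetD)
  ultimately show "\<exists>\<phi> \<in># \<Delta>. holds M I \<phi>"
    using assms(1,2) unfolding valid_sequent_def by auto
qed

text \<open>An eigenlabel is absent from the conclusion of its rule. It may therefore be reinterpreted by
  the world that makes the active formulas of the premise come out as needed.\<close>

lemma fresh_label_reinterpret:
  assumes "\<not> occurs v \<Gamma> \<Delta>" and "range I \<subseteq> worlds M" and "x \<in> worlds M"
  shows "range (I(v := x)) \<subseteq> worlds M"
    and "\<And>\<phi>. \<phi> \<in># \<Gamma> + \<Delta> \<Longrightarrow> holds M (I(v := x)) \<phi> \<longleftrightarrow> holds M I \<phi>"
  using assms by (auto simp: occurs_def holds_fun_upd)

text \<open>The reflexive world serves the rule \<open>Ser\<close> with equal labels. Closure conditions on evidence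
  are available only within the language of the logic, hence the appeals to \<open>G3_lang_sequent\<close>:
  a rule may be used with terms and formulas that occur only in its premises.\<close>

lemma G3_sound_reflexive_world:
  assumes "G3 X CS \<Gamma> \<Delta>"
    and M: "JL_model X CS M" and r: "(r, r) \<in> acc M"
  shows "valid_sequent M \<Gamma> \<Delta>"
  using assms(1)
proof induction
  case (RJust w v t A \<Gamma> \<Delta>)
  show ?case
    unfolding valid_sequent_def
  proof (intro allI impI)
    fix I
    assume I: "range I \<subseteq> worlds M" and hyps: "\<forall>\<phi> \<in># {#Ev w t A#} + \<Gamma>. holds M I \<phi>"
    show "\<exists>\<phi> \<in># \<Delta> + {#Lab w (Just t A)#}. holds M I \<phi>"
    proof (rule ccontr)
      assume neg: "\<not> ?thesis"
      then have "\<not> forces M (I w) (Just t A)" by auto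
      moreover have "I w \<in> evid M t A" using hyps by simp
      ultimately obtain x where x: "(I w, x) \<in> acc M" "\<not> forces M x A" by auto
      then have "x \<in> worlds M" using JL_model_acc[OF M] by blast
      note J = fresh_label_reinterpret[OF RJust.hyps(2) I this]
      have "v \<noteq> w" using RJust.hyps(2) by (auto simp: occurs_def)
      then have "\<forall>\<phi> \<in># {#Rel w v, Ev w t A#} + \<Gamma>. holds M (I(v := x)) \<phi>"
        using x(1) hyps J(2) by auto
      then obtain \<phi> where "\<phi> \<in># \<Delta> + {#Lab v A#}" "holds M (I(v := x)) \<phi>"
        using RJust.IH J(1) unfolding valid_sequent_def by blast
      then show False using x(2) neg J(2) by auto
    qed
  qed
next
  case (AN c F w \<Gamma> \<Delta>)
  show ?case
    by (rule valid_sequent_entailed_left[OF AN.IH])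
      (use JL_model_const[OF M AN.hyps(1)] in auto)
next
  case (Ref w \<Gamma> \<Delta>)
  show ?case
    by (rule valid_sequent_entailed_left[OF Ref.IH])
      (use JL_model_refl[OF M Ref.hyps(1)] in \<open>auto simp: refl_on_def\<close>)
next
  case (Ser w v \<Gamma> \<Delta>)
  show ?case
    unfolding valid_sequent_def
  proof (intro allI impI)
    fix I
    assume I: "range I \<subseteq> worlds M" and hyps: "\<forall>\<phi> \<in># \<Gamma>. holds M I \<phi>"
    obtain x where x: "x \<in> worlds M" "((I(v := x)) w, x) \<in> acc M"
    proof (cases "w = v")
      \<comment> \<open>the atom is \<open>v R v\<close>; seriality yields no world for \<open>v\<close> here, but \<open>r\<close> is one\<close>
      case True
      moreover have "r \<in> worlds M" using JL_model_acc[OF M] r by blast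
      ultimately show thesis using that r by auto
    next
      case False
      moreover have "I w \<in> worlds M" using I by auto
      then obtain x where "(I w, x) \<in> acc M" using JL_model_serial[OF M Ser.hyps(1)] by blast
      moreover from this have "x \<in> worlds M" using JL_model_acc[OF M] by blast
      ultimately show thesis using that by auto
    qed
    note J = fresh_label_reinterpret[OF Ser.hyps(3) I x(1)]
    have "\<forall>\<phi> \<in># {#Rel w v#} + \<Gamma>. holds M (I(v := x)) \<phi>"
      using x(2) hyps J(2) by auto
    then obtain \<phi> where "\<phi> \<in># \<Delta>" "holds M (I(v := x)) \<phi>"
      using Ser.IH J(1) unfolding valid_sequent_def by blast
    then show "\<exists>\<phi> \<in># \<Delta>. holds M I \<phi>" using J(2) by auto
  qed
next
  case (ElPlus w s t A \<Gamma> \<Delta>)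
  have lang: "is_Tm X s" "is_Tm X t" "is_Fm X A"
    using G3_lang_sequent[OF ElPlus.hyps] by (auto simp: lang_sequent_def)
  show ?case
    by (rule valid_sequent_entailed_left[OF ElPlus.IH])
      (use JL_model_Plus[OF M lang] in auto)
next
  case (ErPlus w t s A \<Gamma> \<Delta>)
  have lang: "is_Tm X t" "is_Tm X s" "is_Fm X A"
    using G3_lang_sequent[OF ErPlus.hyps] by (auto simp: lang_sequent_def)
  show ?case
    by (rule valid_sequent_entailed_left[OF ErPlus.IH])
      (use JL_model_Plus[OF M lang] in auto)
next
  case (EApp w s t B A \<Gamma> \<Delta>)
  have lang: "is_Tm X s" "is_Tm X t" "is_Fm X A" "is_Fm X B"
    using G3_lang_sequent[OF EApp.hyps] by (auto simp: lang_sequent_def)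
  show ?case
    by (rule valid_sequent_entailed_left[OF EApp.IH])
      (use JL_model_App[OF M lang] in auto)
next
  case (EBang w t A \<Gamma> \<Delta>)
  have lang: "is_Tm X t" "is_Fm X A"
    using G3_lang_sequent[OF EBang.hyps(2)] by (auto simp: lang_sequent_def)
  show ?case
    by (rule valid_sequent_entailed_left[OF EBang.IH])
      (use JL_model_Bang[OF M EBang.hyps(1) lang] in auto)
next
  case (Mon v t A w \<Gamma> \<Delta>)
  have lang: "is_Tm X t" "is_Fm X A"
    using G3_lang_sequent[OF Mon.hyps(2)] by (auto simp: lang_sequent_def)
  show ?case
    by (rule valid_sequent_entailed_left[OF Mon.IH])
      (use JL_model_mono[OF M Mon.hyps(1) lang] in auto)
next
  case (Trans w u v \<Gamma> \<Delta>)
  show ?case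
    by (rule valid_sequent_entailed_left[OF Trans.IH])
      (auto intro: transD[OF JL_model_trans[OF M Trans.hyps(1)]])
next
  case (EBarQuest w A \<Gamma> \<Delta> t)
  have lang: "is_Tm X t" "is_Fm X A"
    using G3_lang_sequent[OF EBarQuest.hyps(3)] by (auto simp: lang_sequent_def)
  show ?case
    by (rule valid_sequent_cases_left[OF EBarQuest.IH])
      (use JL_model_BarQuest[OF M EBarQuest.hyps(1) lang] in auto)
next
  case (Sym v w \<Gamma> \<Delta>)
  show ?case
    by (rule valid_sequent_entailed_left[OF Sym.IH])
      (auto intro: symD[OF JL_model_sym[OF M Sym.hyps(1)]])
next
  case (SE w t A \<Gamma> \<Delta>)
  have lang: "is_Tm X t" "is_Fm X A"
    using G3_lang_sequent[OF SE.hyps(2)] by (auto simp: lang_sequent_def)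
  show ?case
    by (rule valid_sequent_entailed_left[OF SE.IH])
      (use JL_model_strong_evid[OF M SE.hyps(1) lang] in auto)
next
  case (EQuest w t A \<Gamma> \<Delta>)
  have lang: "is_Tm X t" "is_Fm X A"
    using G3_lang_sequent[OF EQuest.hyps(2)] by (auto simp: lang_sequent_def)
  show ?case
    by (rule valid_sequent_cases_left[OF EQuest.IH])
      (use JL_model_Quest[OF M EQuest.hyps(1) lang] in auto)
next
  case (LJust v A w t \<Gamma> \<Delta>)
  show ?case
    by (rule valid_sequent_entailed_left[OF LJust.IH]) auto
next
  case (E w t A \<Gamma> \<Delta>)
  show ?case
    by (rule valid_sequent_entailed_left[OF E.IH]) auto
qed (simp_all add: valid_sequent_def ball_Un bex_Un; blast)+

section \<open>Soundness\<close>

theorem theorem8p1: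
  fixes X :: "ext_axiom set"
    and CS :: "('x, 'c, 'p) fm set"
    and \<Gamma> \<Delta> :: "('x, 'c, 'p) lfm multiset"
    and M :: "('w, 'x, 'c, 'p) fitting_model"
  assumes "justification_logic X"
    and "constant_specification X CS"
    and "G3 X CS \<Gamma> \<Delta>"
    and "JL_model X CS M"
  shows "valid_sequent M \<Gamma> \<Delta>"
proof (rule valid_sequent_add_pointD)
  have "(None, None) \<in> acc (add_point M)" by (simp add: add_point_simps)
  then show "valid_sequent (add_point M) \<Gamma> \<Delta>"
    by (rule G3_sound_reflexive_world[OF assms(3) JL_model_add_point[OF assms(4,2)]])
qed

end
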